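(* Let $G$ be a connected graph with $n$ vertices and $m$ edges, and let $0<\alpha<1$. Then the generalized closeness $GC(G)$ and the closeness $C(G)$ satisfy \[ \frac{2\left[n\alpha(1-\alpha)-\alpha(1-\alpha^{n})\right]}{(1-\alpha)^2}\;\le\; GC(G)\;\le\;\alpha\, n(n-1), \] \[ 2n-4+(0.5)^{n-2}\;\le\; C(G)\;\le\;\frac{n(n-1)}{2}. \] Moreover, in each of the two formulas, the left-hand inequality is an equality if $G$ is the path $P_n$ on $n$ vertices, and the right-hand inequality is an equality if $G$ is the complete graph $K_n$.
   Context: All graphs are finite and simple. For vertices $i,j$ of a connected graph $G$, $d(i,j)$ denotes the distance (length of a shortest path) between $i$ and $j$. The closeness of $G$ is $C(G)=\sum_{i\in V(G)}\sum_{j\in V(G),\,j\neq i} 2^{-d(i,j)}$. For a fixed real number $0<\alpha<1$, the generalized closeness of $G$ is $GC(G)=\sum_{i\in V(G)}\sum_{j\in V(G),\,j\neq i}\alpha^{d(i,j)}$ (so $C(G)$ is $GC(G)$ with $\alpha=1/2$). *)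

theory Defs
  imports Complex_Main "Graph_Theory.Graph_Theory"
begin

text \<open>
  A finite simple graph is a symmetric digraph without loops and parallel arcs (locale
  \<open>graph\<close>), so that an undirected edge is a pair of opposite arcs.
\<close>

definition edges :: "('a, 'b) pre_digraph \<Rightarrow> 'a set set" where
  "edges G = (\<lambda>e. {tail G e, head G e}) ` arcs G"

definition distance :: "('a, 'b) pre_digraph \<Rightarrow> 'a \<Rightarrow> 'a \<Rightarrow> nat" where
  "distance G u v = (LEAST k. \<exists>p. pre_digraph.apath G u p v \<and> length p = k)"

definition generalized_closeness :: "real \<Rightarrow> ('a, 'b) pre_digraph \<Rightarrow> real" where
  "generalized_closeness \<alpha> G = (\<Sum>i\<in>verts G. \<Sum>j\<in>verts G - {i}. \<alpha> ^ distance G i j)"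

definition closeness :: "('a, 'b) pre_digraph \<Rightarrow> real" where
  "closeness G = (\<Sum>i\<in>verts G. \<Sum>j\<in>verts G - {i}. 2 powi (- int (distance G i j)))"

definition path_graph :: "nat \<Rightarrow> nat pair_pre_digraph" where
  "path_graph n =
    \<lparr>pverts = {..<n}, parcs = {(i, j). i < n \<and> j < n \<and> (j = Suc i \<or> i = Suc j)}\<rparr>"

lemma closeness_eq_generalized: "closeness G = generalized_closeness (1 / 2) G"
  by (simp add: closeness_def generalized_closeness_def power_int_minus power_one_over inverse_eq_divide)

lemma pair_graph_path_graph: "pair_graph (path_graph n)"
proof -
  have "parcs (path_graph n) \<subseteq> {..<n} \<times> {..<n}"
    by (auto simp: path_graph_def)
  then have "finite (parcs (path_graph n))"
    by (rule finite_subset) simp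
  then show ?thesis
    by unfold_locales (auto simp: path_graph_def symmetric_def sym_def)
qed

lemma (in wf_digraph) distance_eq_shortest_path:
  assumes "u \<rightarrow>\<^sup>* v"
  shows "ereal (distance G u v) = \<mu> (\<lambda>_. 1) u v"
proof -
  have cost: "awalk_cost (\<lambda>_. 1) p = length p" for p :: "'b list"
    by (simp add: awalk_cost_def sum_list_triv)
  have "\<exists>k p. apath u p v \<and> length p = k"
    using assms by (auto simp: reachable_apath)
  then have "\<exists>p. apath u p v \<and> length p = distance G u v"
    unfolding distance_def by (rule LeastI_ex)
  then obtain p where p: "apath u p v" "length p = distance G u v" by blast
  have le: "distance G u v \<le> length q" if "awalk u q v" for q
  proof -
    have "apath u (awalk_to_apath q) v"
      using that by (rule apath_awalk_to_apath)
    moreover have "length (awalk_to_apath q) \<le> length q"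
      using awalk_to_path_no_neg_cyc_cost[OF that, of "\<lambda>_. 1"] by (simp add: cost)
    moreover from \<open>apath u (awalk_to_apath q) v\<close> have "distance G u v \<le> length (awalk_to_apath q)"
      unfolding distance_def by (intro Least_le) blast
    ultimately show ?thesis by simp
  qed
  show ?thesis
    unfolding \<mu>_def cost
  proof (rule antisym)
    show "ereal (distance G u v) \<le> (INF p\<in>{p. awalk u p v}. ereal (length p))"
      by (rule INF_greatest) (simp add: le)
    show "(INF p\<in>{p. awalk u p v}. ereal (length p)) \<le> ereal (distance G u v)"
      using p by (intro INF_lower2[of p]) (auto simp: apath_def)
  qed
qed

end

theory Submission
  imports Defs
begin

text \<open>
  Order the vertices so that each new vertex is adjacent to an earlier one, i.e. every initial
  segment is connected. Exploring an initial segment of size \<open>s + 1\<close> from its last vertex \<open>w\<close>,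
  the \<open>k\<close>-th vertex reached is at distance at most \<open>k\<close> from \<open>w\<close>; hence \<open>w\<close> contributes at least
  \<open>2 (\<alpha> + \<dots> + \<alpha>\<^sup>s)\<close> to the generalized closeness. Summing over \<open>s < n\<close> gives the lower
  bound, and for the path all these estimates are equalities. The upper bound is
  \<open>d(i,j) \<ge> 1\<close>, with equality throughout in the complete graph.
\<close>

section \<open>Sums over ordered pairs and geometric sums\<close>

lemma sum_offdiag_insert:
  fixes f :: "'a \<Rightarrow> 'a \<Rightarrow> 'c::comm_monoid_add"
  assumes "finite S" "w \<notin> S"
  shows "(\<Sum>i\<in>insert w S. \<Sum>j\<in>insert w S - {i}. f i j)
    = (\<Sum>i\<in>S. \<Sum>j\<in>S - {i}. f i j) + (\<Sum>j\<in>S. f w j + f j w)"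
proof -
  have "(\<Sum>j\<in>insert w S - {i}. f i j) = (\<Sum>j\<in>S - {i}. f i j) + f i w" if "i \<in> S" for i
  proof -
    have "insert w S - {i} = insert w (S - {i})" using that assms by auto
    then show ?thesis using assms by (simp add: add.commute)
  qed
  then have "(\<Sum>i\<in>S. \<Sum>j\<in>insert w S - {i}. f i j) = (\<Sum>i\<in>S. (\<Sum>j\<in>S - {i}. f i j) + f i w)"
    by (intro sum.cong) auto
  moreover have "insert w S - {w} = S" using assms by auto
  ultimately show ?thesis using assms by (simp add: sum.distrib ac_simps)
qed

lemma sum_offdiag_const:
  assumes "finite S"
  shows "(\<Sum>i\<in>S. \<Sum>j\<in>S - {i}. c) = c * real (card S) * (real (card S) - 1)"
proof -
  have "(\<Sum>j\<in>S - {i}. c) = (real (card S) - 1) * c" if "i \<in> S" for i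
  proof -
    have "1 \<le> card S" using that assms by (auto simp: Suc_le_eq card_gt_0_iff)
    then show ?thesis using that by (simp add: card_Diff_singleton of_nat_diff)
  qed
  then have "(\<Sum>i\<in>S. \<Sum>j\<in>S - {i}. c) = (\<Sum>i\<in>S. (real (card S) - 1) * c)"
    by (intro sum.cong) auto
  then show ?thesis by simp
qed

text \<open>The inner sum is geometric, equal to
  \<open>(\<alpha> - \<alpha> ^ Suc s) / (1 - \<alpha>)\<close>. Twice this double sum is the lower
  bound of the theorem; all estimates work with the double sum, and the closed form enters only at
  the end.\<close>

lemma double_geometric_sum:
  fixes \<alpha> :: real
  assumes "\<alpha> \<noteq> 1"
  shows "(\<Sum>s<n. \<Sum>k=1..s. \<alpha> ^ k)
    = (real n * \<alpha> * (1 - \<alpha>) - \<alpha> * (1 - \<alpha> ^ n)) / (1 - \<alpha>)\<^sup>2"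
proof (induction n)
  case (Suc n)
  have "(\<Sum>k=1..n. \<alpha> ^ k) = (\<alpha> - \<alpha> ^ Suc n) / (1 - \<alpha>)"
  proof (induction n)
    case (Suc n)
    then have "(\<Sum>k=1..Suc n. \<alpha> ^ k) = (\<alpha> - \<alpha> ^ Suc n) / (1 - \<alpha>) + \<alpha> ^ Suc n" by simp
    also have "\<dots> = (\<alpha> - \<alpha> ^ Suc (Suc n)) / (1 - \<alpha>)" using assms by (simp add: divide_simps) algebra
    finally show ?case .
  qed simp
  then have "(\<Sum>s<Suc n. \<Sum>k=1..s. \<alpha> ^ k)
      = (real n * \<alpha> * (1 - \<alpha>) - \<alpha> * (1 - \<alpha> ^ n)) / (1 - \<alpha>)\<^sup>2 + (\<alpha> - \<alpha> ^ Suc n) / (1 - \<alpha>)"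
    using Suc.IH by simp
  also have "(\<alpha> - \<alpha> ^ Suc n) / (1 - \<alpha>) = (\<alpha> - \<alpha> ^ Suc n) * (1 - \<alpha>) / (1 - \<alpha>)\<^sup>2"
    using assms by (simp add: power2_eq_square)
  also have "(real n * \<alpha> * (1 - \<alpha>) - \<alpha> * (1 - \<alpha> ^ n)) / (1 - \<alpha>)\<^sup>2 + \<dots>
      = (real (Suc n) * \<alpha> * (1 - \<alpha>) - \<alpha> * (1 - \<alpha> ^ Suc n)) / (1 - \<alpha>)\<^sup>2"
    by (simp add: add_divide_distrib[symmetric] algebra_simps)
  finally show ?case .
qed simp

text \<open>Appending the end vertex \<open>n\<close> to the path on \<open>{..<n}\<close> adds each
  of the distances 1, ..., \<open>n\<close> exactly once in each direction, so the recursion over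
  initial segments gives an equality.\<close>

lemma sum_power_absdiff_path:
  fixes \<alpha> :: real
  shows "(\<Sum>i<n. \<Sum>j\<in>{..<n} - {i}. \<alpha> ^ nat \<bar>int i - int j\<bar>) = 2 * (\<Sum>s<n. \<Sum>k=1..s. \<alpha> ^ k)"
proof (induction n)
  case (Suc n)
  have "(\<Sum>j<n. \<alpha> ^ nat \<bar>int n - int j\<bar> + \<alpha> ^ nat \<bar>int j - int n\<bar>) = (\<Sum>j<n. 2 * \<alpha> ^ (n - j))"
    by (intro sum.cong) (auto simp: nat_diff_distrib abs_if of_nat_diff[symmetric] simp del: of_nat_diff)
  also have "\<dots> = 2 * (\<Sum>k=1..n. \<alpha> ^ k)"
    unfolding sum_distrib_left
    by (rule sum.reindex_bij_witness[of _ "\<lambda>k. n - k" "\<lambda>j. n - j"]) auto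
  finally show ?case
    using Suc.IH sum_offdiag_insert[of "{..<n}" n "\<lambda>i j. \<alpha> ^ nat \<bar>int i - int j\<bar>"]
    by (simp only: lessThan_Suc[symmetric] sum.lessThan_Suc[of "\<lambda>s. \<Sum>k=1..s. \<alpha> ^ k"]
        distrib_left) simp
qed simp

section \<open>Growing connected sets: the lower bound for abstract distances\<close>

text \<open>For symmetric \<open>E\<close> this is connectedness of the subgraph induced on
  \<open>S\<close>, phrased through cuts: the edge leaving \<open>T\<close> directly supplies the
  next vertex of a greedy exploration, with no paths inside \<open>S\<close> to handle.\<close>

definition cut_connected :: "('a \<times> 'a) set \<Rightarrow> 'a set \<Rightarrow> bool" where
  "cut_connected E S \<longleftrightarrow> (\<forall>T. T \<subset> S \<longrightarrow> T \<noteq> {} \<longrightarrow> (\<exists>a\<in>T. \<exists>b\<in>S - T. (a, b) \<in> E))"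

lemma cut_connectedD:
  assumes "cut_connected E S" "T \<subset> S" "T \<noteq> {}"
  obtains a b where "a \<in> T" "b \<in> S" "b \<notin> T" "(a, b) \<in> E"
  using assms unfolding cut_connected_def by (meson DiffE)

text \<open>A cut of \<open>insert b S\<close> either splits \<open>S\<close>, and then an edge
  within \<open>S\<close> crosses it, or leaves \<open>S\<close> on one side, and then the edge
  between \<open>a\<close> and \<open>b\<close> crosses it. Symmetry of \<open>E\<close> orients
  that edge outwards when \<open>T = {b}\<close>.\<close>

lemma cut_connected_insert:
  assumes "cut_connected E S" "sym E" "a \<in> S" "(a, b) \<in> E"
  shows "cut_connected E (insert b S)"
  unfolding cut_connected_def
proof (intro allI impI)
  fix T assume T: "T \<subset> insert b S" "T \<noteq> {}"
  consider "T \<inter> S = {}" | "S \<subseteq> T" | "T \<inter> S \<subset> S" "T \<inter> S \<noteq> {}" by blast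
  then show "\<exists>x\<in>T. \<exists>y\<in>insert b S - T. (x, y) \<in> E"
  proof cases
    case 1
    then have "T = {b}" "b \<notin> S" using T by auto
    then show ?thesis using assms 1 by (auto dest: symD)
  next
    case 2
    then show ?thesis using assms T by blast
  next
    case 3
    then obtain x y where "x \<in> T \<inter> S" "y \<in> S" "y \<notin> T \<inter> S" "(x, y) \<in> E"
      using cut_connectedD[OF assms(1)] by metis
    then show ?thesis by blast
  qed
qed

text \<open>Explore \<open>S\<close> greedily from \<open>v\<close>. The function \<open>d\<close>
  grows by at most 1 along an edge, so the \<open>k\<close>-th new vertex has level at most
  \<open>k\<close> and contributes at least \<open>\<alpha> ^ k\<close>, because \<alpha> <
  1.\<close>

lemma sum_power_level_ge:
  fixes \<alpha> :: real and d :: "'a \<Rightarrow> nat"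
  assumes "finite S" "cut_connected E S" "v \<in> S" "d v = 0" "0 < \<alpha>" "\<alpha> < 1"
    and step: "\<And>a b. a \<in> S \<Longrightarrow> b \<in> S \<Longrightarrow> (a, b) \<in> E \<Longrightarrow> d b \<le> Suc (d a)"
  shows "(\<Sum>k=1..card S - 1. \<alpha> ^ k) \<le> (\<Sum>j\<in>S - {v}. \<alpha> ^ d j)"
proof -
  \<comment> \<open>The level bound on all of \<open>T\<close> is carried along with the sum:
    whichever vertex of \<open>T\<close> the next edge leaves, its other end has level at most
    \<open>Suc k\<close>.\<close>
  have grow: "\<exists>T\<subseteq>S. v \<in> T \<and> card T = Suc k \<and> (\<forall>a\<in>T. d a \<le> k)
      \<and> (\<Sum>k=1..k. \<alpha> ^ k) \<le> (\<Sum>j\<in>T - {v}. \<alpha> ^ d j)" if "k < card S" for k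
    using that
  proof (induction k)
    case 0
    then show ?case using assms by (intro exI[of _ "{v}"]) auto
  next
    case (Suc k)
    then obtain T where T: "T \<subseteq> S" "v \<in> T" "card T = Suc k" "\<forall>a\<in>T. d a \<le> k"
      "(\<Sum>k=1..k. \<alpha> ^ k) \<le> (\<Sum>j\<in>T - {v}. \<alpha> ^ d j)" by auto
    have "finite T" using T(1) assms(1) by (rule finite_subset)
    have "T \<subset> S" "T \<noteq> {}" using T Suc.prems by auto
    then obtain a b where ab: "a \<in> T" "b \<in> S" "b \<notin> T" "(a, b) \<in> E"
      using cut_connectedD[OF assms(2)] by metis
    have "d b \<le> Suc k" using step[of a b] T ab by fastforce
    then have "\<alpha> ^ Suc k \<le> \<alpha> ^ d b" using assms by (intro power_decreasing) auto
    moreover have "insert b T - {v} = insert b (T - {v})" using ab T by auto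
    ultimately have "(\<Sum>k=1..Suc k. \<alpha> ^ k) \<le> (\<Sum>j\<in>insert b T - {v}. \<alpha> ^ d j)"
      using T(5) ab \<open>finite T\<close> by simp
    then show ?case
      using T ab \<open>finite T\<close> \<open>d b \<le> Suc k\<close> by (intro exI[of _ "insert b T"]) auto
  qed
  have "0 < card S" using assms(1,3) by (auto simp: card_gt_0_iff)
  then obtain T where "T \<subseteq> S" "card T = card S"
    and *: "(\<Sum>k=1..card S - 1. \<alpha> ^ k) \<le> (\<Sum>j\<in>T - {v}. \<alpha> ^ d j)"
    using grow[of "card S - 1"] by auto
  then have "T = S" using assms(1) by (simp add: card_subset_eq)
  with * show ?thesis by simp
qed

text \<open>A second greedy growth, now of the segment \<open>S\<close> itself. Each new vertex
  \<open>w\<close> is the root of an exploration of the enlarged segment, and symmetry of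
  \<open>d\<close> doubles its contribution. Throughout, \<open>d\<close> stays the distance in all
  of \<open>V\<close>; its step property on edges inside a segment is inherited.\<close>

lemma sum_power_dist_ge:
  fixes \<alpha> :: real and d :: "'a \<Rightarrow> 'a \<Rightarrow> nat"
  assumes "finite V" "cut_connected E V" "sym E" "0 < \<alpha>" "\<alpha> < 1"
    and refl: "\<And>a. a \<in> V \<Longrightarrow> d a a = 0"
    and comm: "\<And>a b. a \<in> V \<Longrightarrow> b \<in> V \<Longrightarrow> d a b = d b a"
    and step: "\<And>v a b. v \<in> V \<Longrightarrow> a \<in> V \<Longrightarrow> b \<in> V \<Longrightarrow> (a, b) \<in> E \<Longrightarrow> d v b \<le> Suc (d v a)"
  shows "2 * (\<Sum>s<card V. \<Sum>k=1..s. \<alpha> ^ k) \<le> (\<Sum>i\<in>V. \<Sum>j\<in>V - {i}. \<alpha> ^ d i j)"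
proof (cases "V = {}")
  case False
  \<comment> \<open>The growth starts from one vertex, hence the size \<open>Suc r\<close> and the
    separate case of empty \<open>V\<close>.\<close>
  have grow: "\<exists>S\<subseteq>V. card S = Suc r \<and> cut_connected E S
      \<and> 2 * (\<Sum>s<Suc r. \<Sum>k=1..s. \<alpha> ^ k) \<le> (\<Sum>i\<in>S. \<Sum>j\<in>S - {i}. \<alpha> ^ d i j)"
    if "r < card V" for r
    using that
  proof (induction r)
    case 0
    then obtain v where "v \<in> V" using False by auto
    then show ?case by (intro exI[of _ "{v}"]) (auto simp: cut_connected_def)
  next
    case (Suc r)
    then obtain S where S: "S \<subseteq> V" "card S = Suc r" "cut_connected E S"
      "2 * (\<Sum>s<Suc r. \<Sum>k=1..s. \<alpha> ^ k) \<le> (\<Sum>i\<in>S. \<Sum>j\<in>S - {i}. \<alpha> ^ d i j)" by auto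
    have "finite S" using S(1) assms(1) by (rule finite_subset)
    have "S \<subset> V" "S \<noteq> {}" using S Suc.prems by auto
    then obtain a w where aw: "a \<in> S" "w \<in> V" "w \<notin> S" "(a, w) \<in> E"
      using cut_connectedD[OF assms(2)] by metis
    \<comment> \<open>The exploration is rooted at the new vertex, so it is the enlarged segment
      that has to be connected.\<close>
    have sp: "cut_connected E (insert w S)" using cut_connected_insert[OF S(3) assms(3)] aw by blast
    have "insert w S \<subseteq> V" using S aw by auto
    then have "(\<Sum>k=1..card (insert w S) - 1. \<alpha> ^ k) \<le> (\<Sum>j\<in>insert w S - {w}. \<alpha> ^ d w j)"
      using sp \<open>finite S\<close> assms(4,5) aw(2) refl
      by (intro sum_power_level_ge[where E = E] step) auto
    then have le: "(\<Sum>k=1..Suc r. \<alpha> ^ k) \<le> (\<Sum>j\<in>S. \<alpha> ^ d w j)"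
      using aw S(2) \<open>finite S\<close> by simp
    have two: "(\<Sum>j\<in>S. \<alpha> ^ d w j + \<alpha> ^ d j w) = 2 * (\<Sum>j\<in>S. \<alpha> ^ d w j)"
      unfolding sum_distrib_left using S(1) aw comm by (intro sum.cong) auto
    have "2 * (\<Sum>s<Suc (Suc r). \<Sum>k=1..s. \<alpha> ^ k)
        = 2 * (\<Sum>s<Suc r. \<Sum>k=1..s. \<alpha> ^ k) + 2 * (\<Sum>k=1..Suc r. \<alpha> ^ k)"
      by (simp only: sum.lessThan_Suc[of _ "Suc r"] distrib_left)
    also have "\<dots> \<le> (\<Sum>i\<in>S. \<Sum>j\<in>S - {i}. \<alpha> ^ d i j) + 2 * (\<Sum>j\<in>S. \<alpha> ^ d w j)"
      using S(4) le by (intro add_mono mult_left_mono) auto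
    also have "\<dots> = (\<Sum>i\<in>insert w S. \<Sum>j\<in>insert w S - {i}. \<alpha> ^ d i j)"
      by (simp only: sum_offdiag_insert[OF \<open>finite S\<close> aw(3)] two)
    finally have "2 * (\<Sum>s<Suc (Suc r). \<Sum>k=1..s. \<alpha> ^ k)
        \<le> (\<Sum>i\<in>insert w S. \<Sum>j\<in>insert w S - {i}. \<alpha> ^ d i j)" .
    then show ?case
      using S aw \<open>finite S\<close> sp by (intro exI[of _ "insert w S"]) auto
  qed
  have "0 < card V" using assms(1) False by (simp add: card_gt_0_iff)
  then obtain S where "S \<subseteq> V" "card S = card V"
    and *: "2 * (\<Sum>s<card V. \<Sum>k=1..s. \<alpha> ^ k) \<le> (\<Sum>i\<in>S. \<Sum>j\<in>S - {i}. \<alpha> ^ d i j)"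
    using grow[of "card V - 1"] by auto
  then have "S = V" using assms(1) by (simp add: card_subset_eq)
  with * show ?thesis by simp
qed simp

section \<open>Distances and walks\<close>

context wf_digraph
begin

text \<open>The definition of \<open>distance\<close> minimises over \<open>apath\<close>. Passing
  through the shortest-path cost \<mu> admits arbitrary walks, so walks can be extended and reversed
  below without checking for repeated vertices.\<close>

lemma distance_le_length:
  assumes "awalk u p v"
  shows "distance G u v \<le> length p"
proof -
  have "ereal (distance G u v) \<le> ereal (awalk_cost (\<lambda>_. 1) p)"
    using min_cost_le_walk_cost[OF assms, of "\<lambda>_. 1"]
      distance_eq_shortest_path[OF reachable_awalkI[OF assms]] by simp
  then show ?thesis by (simp add: awalk_cost_def sum_list_triv)
qed

lemma distance_awalk:
  assumes "u \<rightarrow>\<^sup>* v"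
  obtains p where "awalk u p v" "length p = distance G u v"
proof -
  have "\<exists>k p. apath u p v \<and> length p = k"
    using assms by (auto simp: reachable_apath)
  then have "\<exists>p. apath u p v \<and> length p = distance G u v"
    unfolding distance_def by (rule LeastI_ex)
  then show ?thesis using that by (auto simp: apath_def)
qed

lemma distance_refl: "u \<in> verts G \<Longrightarrow> distance G u u = 0"
  using distance_le_length[of u "[]" u] by (simp add: awalk_Nil_iff)

lemma distance_pos:
  assumes "u \<rightarrow>\<^sup>* v" "u \<noteq> v"
  shows "0 < distance G u v"
proof -
  obtain p where "awalk u p v" "length p = distance G u v"
    using distance_awalk[OF assms(1)] .
  then show ?thesis using assms(2) by (cases p) (auto simp: awalk_Nil_iff)
qed

lemma distance_step:
  assumes "u \<rightarrow>\<^sup>* v" "(v, w) \<in> arcs_ends G"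
  shows "distance G u w \<le> Suc (distance G u v)"
proof -
  obtain p where p: "awalk u p v" "length p = distance G u v"
    using distance_awalk[OF assms(1)] .
  obtain e where "e \<in> arcs G" "tail G e = v" "head G e = w"
    using assms(2) by (auto simp: arcs_ends_conv)
  then have "awalk v [e] w" by (auto simp: awalk_simps)
  then have "awalk u (p @ [e]) w" using p(1) by (rule awalk_appendI[rotated])
  from distance_le_length[OF this] show ?thesis by (simp add: p(2))
qed

text \<open>Telescoping along a shortest walk, since each arc changes \<open>h\<close> by at most 1.
  This bounds distances from below; for the path graph, \<open>h\<close> will be the position of a
  vertex.\<close>

lemma distance_lipschitz:
  fixes h :: "'a \<Rightarrow> int"
  assumes "u \<rightarrow>\<^sup>* v"
    and h: "\<And>a b. (a, b) \<in> arcs_ends G \<Longrightarrow> \<bar>h a - h b\<bar> \<le> 1"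
  shows "\<bar>h u - h v\<bar> \<le> int (distance G u v)"
proof -
  obtain p where p: "awalk u p v" "length p = distance G u v"
    using distance_awalk[OF assms(1)] .
  have "\<bar>h u - h v\<bar> \<le> int (length p)" if "awalk u p v" for u p
    using that
  proof (induction p arbitrary: u)
    case (Cons e p)
    have "\<bar>h (tail G e) - h (head G e)\<bar> \<le> 1"
      using Cons.prems by (intro h) (auto simp: awalk_Cons_iff arcs_ends_conv)
    then show ?case using Cons.IH[of "head G e"] Cons.prems by (auto simp: awalk_Cons_iff)
  qed (simp add: awalk_Nil_iff)
  from this[OF p(1)] show ?thesis by (simp only: p(2))
qed

end

text \<open>Replacing every arc of a walk by an opposite one reverses the walk and keeps its
  length.\<close>

lemma (in sym_digraph) distance_commute:
  assumes "u \<rightarrow>\<^sup>* v"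
  shows "distance G u v = distance G v u"
proof -
  have rev: "\<exists>q. awalk b q a \<and> length q = length p" if "awalk a p b" for a p b
    using that
  proof (induction p arbitrary: a)
    case Nil
    then show ?case by (auto simp: awalk_Nil_iff)
  next
    case (Cons e p)
    then obtain q where q: "awalk b q (head G e)" "length q = length p"
      by (auto simp: awalk_Cons_iff)
    obtain e' where "e' \<in> arcs G" "tail G e' = head G e" "head G e' = tail G e"
      using sym_arcs Cons.prems by (auto simp: symmetric_conv awalk_Cons_iff dest!: bspec[of _ _ e])
    then have "awalk (head G e) [e'] a" using Cons.prems by (auto simp: awalk_simps)
    then have "awalk b (q @ [e']) a" using q(1) by (rule awalk_appendI[rotated])
    then show ?case using q(2) by (intro exI[of _ "q @ [e']"]) auto
  qed
  have le: "distance G b a \<le> distance G a b" if ab: "a \<rightarrow>\<^sup>* b" for a b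
  proof -
    obtain p where p: "awalk a p b" "length p = distance G a b"
      using distance_awalk[OF ab] .
    then obtain q where "awalk b q a" "length q = distance G a b" using rev by metis
    then show ?thesis using distance_le_length by metis
  qed
  have "v \<rightarrow>\<^sup>* u" using assms rev by (metis reachable_awalk)
  then show ?thesis using le assms by (simp add: antisym)
qed

section \<open>Closeness of connected graphs, complete graphs and paths\<close>

context graph
begin

lemma connected_reachable:
  assumes "Digraph_Component.connected G" "u \<in> verts G" "v \<in> verts G"
  shows "u \<rightarrow>\<^sup>* v"
  using symmetric_connected_imp_strongly_connected[OF sym_arcs assms(1)] assms(2,3) by auto

text \<open>If no arc left \<open>T\<close>, a walk starting in \<open>T\<close> could never leave
  it, contradicting the reachability of a vertex outside \<open>T\<close>.\<close>

lemma connected_cut_connected: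
  assumes "Digraph_Component.connected G"
  shows "cut_connected (arcs_ends G) (verts G)"
  unfolding cut_connected_def
proof (intro allI impI)
  fix T assume T: "T \<subset> verts G" "T \<noteq> {}"
  then obtain u v where uv: "u \<in> T" "v \<in> verts G" "v \<notin> T" by blast
  have "v \<in> T" if closed: "\<And>a b. a \<in> T \<Longrightarrow> (a, b) \<in> arcs_ends G \<Longrightarrow> b \<in> T"
  proof -
    obtain p where "awalk u p v"
      using connected_reachable[OF assms, of u v] uv T by (auto simp: reachable_awalk)
    then show ?thesis
      using uv(1)
    proof (induction p arbitrary: u)
      case (Cons e p)
      have e: "e \<in> arcs G" "u = tail G e" "awalk (head G e) p v"
        using Cons.prems(1) by (simp_all add: awalk_Cons_iff)
      then have "(u, head G e) \<in> arcs_ends G" by (auto simp: arcs_ends_conv)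
      then show ?case using Cons.IH[OF e(3)] closed Cons.prems(2) by blast
    qed (simp add: awalk_Nil_iff)
  qed
  then obtain a b where "a \<in> T" "(a, b) \<in> arcs_ends G" "b \<notin> T" using uv(3) by blast
  then show "\<exists>a\<in>T. \<exists>b\<in>verts G - T. (a, b) \<in> arcs_ends G"
    using adj_in_verts(2) by blast
qed

lemma generalized_closeness_ge:
  assumes "Digraph_Component.connected G" "0 < \<alpha>" "\<alpha> < 1"
  shows "2 * (\<Sum>s<card (verts G). \<Sum>k=1..s. \<alpha> ^ k) \<le> generalized_closeness \<alpha> G"
  unfolding generalized_closeness_def
proof (rule sum_power_dist_ge)
  show "sym (arcs_ends G)" using sym_arcs by (simp add: symmetric_def)
  show "cut_connected (arcs_ends G) (verts G)" using assms(1) by (rule connected_cut_connected)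
  show "distance G a b = distance G b a" if "a \<in> verts G" "b \<in> verts G" for a b
    using connected_reachable[OF assms(1) that] by (rule distance_commute)
  show "distance G v b \<le> Suc (distance G v a)"
    if "v \<in> verts G" "a \<in> verts G" "(a, b) \<in> arcs_ends G" for v a b
    using connected_reachable[OF assms(1) that(1,2)] that(3) by (rule distance_step)
qed (use assms distance_refl in auto)

lemma generalized_closeness_le:
  assumes "Digraph_Component.connected G" "0 < \<alpha>" "\<alpha> < 1"
  shows "generalized_closeness \<alpha> G \<le> \<alpha> * real (card (verts G)) * (real (card (verts G)) - 1)"
proof -
  have "\<alpha> ^ distance G i j \<le> \<alpha>" if "i \<in> verts G" "j \<in> verts G - {i}" for i j
  proof -
    have "0 < distance G i j" using that connected_reachable[OF assms(1)] by (intro distance_pos) auto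
    then show ?thesis using assms power_decreasing[of 1 "distance G i j" \<alpha>] by simp
  qed
  then show ?thesis
    unfolding generalized_closeness_def sum_offdiag_const[OF finite_verts, symmetric]
    by (intro sum_mono)
qed

lemma generalized_closeness_complete:
  assumes "complete_digraph n G" "Digraph_Component.connected G"
  shows "generalized_closeness \<alpha> G = \<alpha> * real n * (real n - 1)"
proof -
  have "distance G i j = 1" if "i \<in> verts G" "j \<in> verts G - {i}" for i j
  proof (rule antisym)
    have "(i, j) \<in> arcs_ends G" using assms that by (auto simp: complete_digraph_def)
    then show "distance G i j \<le> 1" using distance_step[of i i j] distance_refl[of i] that by simp
    show "1 \<le> distance G i j"
      using distance_pos[of i j] connected_reachable[OF assms(2), of i j] that by auto
  qed
  then have "generalized_closeness \<alpha> G = (\<Sum>i\<in>verts G. \<Sum>j\<in>verts G - {i}. \<alpha>)"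
    unfolding generalized_closeness_def by (intro sum.cong) auto
  then show ?thesis
    using assms(1) sum_offdiag_const[OF finite_verts] by (simp add: complete_digraph_def)
qed

text \<open>One inequality is the general lower bound. For the other it suffices that the distance
  of the vertices at positions \<open>i\<close> and \<open>j\<close> is at least their difference,
  since \<alpha> < 1 turns larger exponents into smaller terms; exact distances are never
  computed.\<close>

lemma generalized_closeness_path:
  assumes "digraph_iso (with_proj (path_graph n)) G" "Digraph_Component.connected G"
    and \<alpha>: "0 < \<alpha>" "\<alpha> < 1"
  shows "generalized_closeness \<alpha> G = 2 * (\<Sum>s<n. \<Sum>k=1..s. \<alpha> ^ k)"
proof (rule antisym)
  let ?P = "with_proj (path_graph n)"
  obtain f where f: "pre_digraph.digraph_isomorphism ?P f" "G = app_iso f ?P"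
    using assms(1) by (auto simp: digraph_iso_def)
  define g where "g = iso_verts f"
  have inj: "inj_on g {..<n}"
    using pre_digraph.digraph_isomorphism_inj_on_verts[OF f(1)] by (simp add: g_def path_graph_def)
  have verts: "verts G = g ` {..<n}"
    using f(2) by (simp add: g_def path_graph_def)
  have ends: "arcs_ends G = (\<lambda>(u, v). (g u, g v)) ` parcs (path_graph n)"
  proof -
    interpret P: wf_digraph ?P using f(1) by (simp add: pre_digraph.digraph_isomorphism_def)
    show ?thesis using P.arcs_ends_app_iso_eq[OF f(1)] f(2) by (simp add: g_def)
  qed
  show "2 * (\<Sum>s<n. \<Sum>k=1..s. \<alpha> ^ k) \<le> generalized_closeness \<alpha> G"
    using generalized_closeness_ge[OF assms(2) \<alpha>] verts card_image[OF inj] by simp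
  \<comment> \<open>The position of \<open>v\<close> on the path, read off by inverting the
    isomorphism on vertices; adjacent vertices have consecutive positions.\<close>
  define h where "h v = int (inv_into {..<n} g v)" for v
  have h: "h (g i) = int i" if "i < n" for i
    using that inj by (simp add: h_def)
  have lip: "\<bar>h a - h b\<bar> \<le> 1" if "(a, b) \<in> arcs_ends G" for a b
    using that by (auto simp: ends path_graph_def h)
  have "generalized_closeness \<alpha> G = (\<Sum>i<n. \<Sum>j\<in>{..<n} - {i}. \<alpha> ^ distance G (g i) (g j))"
  proof -
    have "g ` {..<n} - {g i} = g ` ({..<n} - {i})" if "i < n" for i
      using that inj by (auto dest: inj_onD)
    moreover have "inj_on g ({..<n} - {i})" for i
      using inj by (rule inj_on_subset) auto
    ultimately show ?thesis
      unfolding generalized_closeness_def verts by (simp add: sum.reindex inj)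
  qed
  also have "\<dots> \<le> (\<Sum>i<n. \<Sum>j\<in>{..<n} - {i}. \<alpha> ^ nat \<bar>int i - int j\<bar>)"
  proof (intro sum_mono power_decreasing)
    fix i j assume "i \<in> {..<n}" "j \<in> {..<n} - {i}"
    then have ij: "i < n" "j < n" by auto
    then have "g i \<rightarrow>\<^sup>* g j" by (intro connected_reachable[OF assms(2)]) (auto simp: verts)
    from distance_lipschitz[OF this, of h, OF lip]
    show "nat \<bar>int i - int j\<bar> \<le> distance G (g i) (g j)" by (simp add: h ij)
  qed (use \<alpha> in auto)
  also have "\<dots> = 2 * (\<Sum>s<n. \<Sum>k=1..s. \<alpha> ^ k)" by (rule sum_power_absdiff_path)
  finally show "generalized_closeness \<alpha> G \<le> 2 * (\<Sum>s<n. \<Sum>k=1..s. \<alpha> ^ k)" .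
qed

end

theorem theorem3p1:
  fixes G :: "('a, 'b) pre_digraph" and n m :: nat and \<alpha> :: real
  assumes "graph G" and "Digraph_Component.connected G"
    and "card (verts G) = n" and "card (edges G) = m"
    and "0 < \<alpha>" and "\<alpha> < 1"
  shows "2 * (real n * \<alpha> * (1 - \<alpha>) - \<alpha> * (1 - \<alpha> ^ n)) / (1 - \<alpha>)\<^sup>2 \<le> generalized_closeness \<alpha> G
    \<and> generalized_closeness \<alpha> G \<le> \<alpha> * real n * (real n - 1)
    \<and> 2 * real n - 4 + (1 / 2) powi (int n - 2) \<le> closeness G
    \<and> closeness G \<le> real n * (real n - 1) / 2
    \<and> (digraph_iso (with_proj (path_graph n)) G \<longrightarrow>
        2 * (real n * \<alpha> * (1 - \<alpha>) - \<alpha> * (1 - \<alpha> ^ n)) / (1 - \<alpha>)\<^sup>2 = generalized_closeness \<alpha> G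
        \<and> 2 * real n - 4 + (1 / 2) powi (int n - 2) = closeness G)
    \<and> (complete_digraph n G \<longrightarrow>
        generalized_closeness \<alpha> G = \<alpha> * real n * (real n - 1)
        \<and> closeness G = real n * (real n - 1) / 2)"
proof -
  interpret graph G by fact
  \<comment> \<open>The exponent \<open>int n - 2\<close> is an integer, negative for
    \<open>n = 1\<close>, where the power is 2 and the whole bound is 0.\<close>
  have half: "2 * (\<Sum>s<n. \<Sum>k=1..s. (1 / 2 :: real) ^ k) = 2 * real n - 4 + (1 / 2) powi (int n - 2)"
  proof -
    have "(1 / 2 :: real) powi (int n - 2) = 4 * (1 / 2) ^ n"
      by (simp add: power_int_diff power_one_over field_simps)
    then show ?thesis
      using double_geometric_sum[of "1 / 2" n] by (simp add: power2_eq_square diff_divide_distrib)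
  qed
  have gen: "2 * (\<Sum>s<n. \<Sum>k=1..s. \<alpha> ^ k)
      = 2 * (real n * \<alpha> * (1 - \<alpha>) - \<alpha> * (1 - \<alpha> ^ n)) / (1 - \<alpha>)\<^sup>2"
    using double_geometric_sum[of \<alpha> n] assms by simp
  show ?thesis
    \<comment> \<open>With both closed forms folded back into double sums, the claims on
      \<open>closeness\<close> are the case \<alpha> = 1/2 of the same lemmas.\<close>
    unfolding closeness_eq_generalized gen[symmetric] half[symmetric]
  proof (intro conjI impI)
    show "2 * (\<Sum>s<n. \<Sum>k=1..s. \<alpha> ^ k) \<le> generalized_closeness \<alpha> G"
      "2 * (\<Sum>s<n. \<Sum>k=1..s. (1 / 2) ^ k) \<le> generalized_closeness (1 / 2) G"
      using generalized_closeness_ge[OF assms(2)] assms(3,5,6) by auto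
    show "generalized_closeness \<alpha> G \<le> \<alpha> * real n * (real n - 1)"
      using generalized_closeness_le[OF assms(2)] assms(3,5,6) by auto
    show "generalized_closeness (1 / 2) G \<le> real n * (real n - 1) / 2"
      using generalized_closeness_le[OF assms(2), of "1 / 2"] assms(3) by simp
  next
    assume path: "digraph_iso (with_proj (path_graph n)) G"
    show "2 * (\<Sum>s<n. \<Sum>k=1..s. \<alpha> ^ k) = generalized_closeness \<alpha> G"
      "2 * (\<Sum>s<n. \<Sum>k=1..s. (1 / 2) ^ k) = generalized_closeness (1 / 2) G"
      using generalized_closeness_path[OF path assms(2)] assms(5,6) by auto
  next
    assume complete: "complete_digraph n G"
    show "generalized_closeness \<alpha> G = \<alpha> * real n * (real n - 1)"
      "generalized_closeness (1 / 2) G = real n * (real n - 1) / 2"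
      using generalized_closeness_complete[OF complete assms(2)] by simp_all
  qed
qed

end
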